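(* Let $S$ be a numerical semigroup with $\mathrm{m}(S)<\mathrm{F}(S)$. Then the following conditions are equivalent: (1) $S$ is a MED-semigroup with maximal reduced type; (2) there exist integers $F,m$ such that $2\le m<F$, $m$ does not divide $F$, and $S=\Delta(F,m)$.
   Context: $\mathbb{N}=\{z\in\mathbb{Z}\mid z\ge 0\}$. A numerical semigroup is a submonoid $S$ of $(\mathbb{N},+)$ (containing $0$) with $\mathbb{N}\setminus S$ finite. The multiplicity $\mathrm{m}(S)$ is the smallest element of $S\setminus\{0\}$; the Frobenius number $\mathrm{F}(S)$ is the largest element of $\mathbb{Z}\setminus S$. Every numerical semigroup has a unique minimal system of generators $\mathrm{msg}(S)$; its cardinality $\mathrm{e}(S)$ is the embedding dimension. $S$ is a MED-semigroup (has maximal embedding dimension) if $\mathrm{e}(S)=\mathrm{m}(S)$. The set of pseudo-Frobenius numbers is $\mathrm{PF}(S)=\{x\in\mathbb{Z}\setminus S\mid x+s\in S\text{ for all }0\ne s\in S\}$, and the type $\mathrm{t}(S)$ is its cardinality. Put $\mathrm{rPF}(S)=\{x\in\mathbb{Z}\setminus S\mid \mathrm{F}(S)-\mathrm{m}(S)+1\le x\le \mathrm{F}(S)\}$ and let $s(S)$ be its cardinality (the reduced type); $S$ has maximal reduced type if $s(S)=\mathrm{t}(S)$. For integers $m,F$ with $2\le m<F$ and $m\nmid F$, $\Delta(F,m)=\langle m\rangle\cup\{x\in\mathbb{N}\mid x\ge F+1\}$, where $\langle m\rangle=\{\lambda m\mid\lambda\in\mathbb{N}\}$. *)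

theory Defs
  imports Complex_Main
begin

text \<open>
  As \<open>F(S)\<close>, \<open>PF(S)\<close> and \<open>rPF(S)\<close> are taken relative to the integers, the naturals are
  represented as the subset \<^term>\<open>{0..} :: int set\<close>, and numerical semigroups as sets of integers.
\<close>

definition submonoid_nat :: "int set \<Rightarrow> bool" where
  "submonoid_nat M \<longleftrightarrow> M \<subseteq> {0..} \<and> 0 \<in> M \<and> (\<forall>x\<in>M. \<forall>y\<in>M. x + y \<in> M)"

definition numerical_semigroup :: "int set \<Rightarrow> bool" where
  "numerical_semigroup S \<longleftrightarrow> submonoid_nat S \<and> finite ({0..} - S)"

definition mult_of :: "int set \<Rightarrow> int" where
  "mult_of S = (LEAST x. x \<in> S - {0})"

definition frobenius :: "int set \<Rightarrow> int" where
  "frobenius S = (GREATEST x. x \<in> - S)"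

text \<open>
  \<^term>\<open>submonoid_nat hull A\<close> is the least submonoid containing \<open>A\<close>. For \<open>A\<close> not contained in
  \<^term>\<open>{0..} :: int set\<close> it is \<^term>\<open>UNIV :: int set\<close>, so such \<open>A\<close> never generates a
  numerical semigroup.
\<close>

definition minimal_generating_system :: "int set \<Rightarrow> int set \<Rightarrow> bool" where
  "minimal_generating_system S A \<longleftrightarrow>
     submonoid_nat hull A = S \<and> (\<forall>B. B \<subset> A \<longrightarrow> submonoid_nat hull B \<noteq> S)"

definition msg :: "int set \<Rightarrow> int set" where
  "msg S = (THE A. minimal_generating_system S A)"

definition embdim :: "int set \<Rightarrow> nat" where
  "embdim S = card (msg S)"

definition MED_semigroup :: "int set \<Rightarrow> bool" where
  "MED_semigroup S \<longleftrightarrow> numerical_semigroup S \<and> int (embdim S) = mult_of S"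

definition PF :: "int set \<Rightarrow> int set" where
  "PF S = {x \<in> - S. \<forall>s\<in>S. s \<noteq> 0 \<longrightarrow> x + s \<in> S}"

definition type_of :: "int set \<Rightarrow> nat" where
  "type_of S = card (PF S)"

definition rPF :: "int set \<Rightarrow> int set" where
  "rPF S = {x \<in> - S. frobenius S - mult_of S + 1 \<le> x \<and> x \<le> frobenius S}"

definition reduced_type :: "int set \<Rightarrow> nat" where
  "reduced_type S = card (rPF S)"

definition maximal_reduced_type :: "int set \<Rightarrow> bool" where
  "maximal_reduced_type S \<longleftrightarrow> reduced_type S = type_of S"

definition Delta :: "int \<Rightarrow> int \<Rightarrow> int set" where
  "Delta F m = {l * m | l. l \<in> {0..}} \<union> {x \<in> {0..}. x \<ge> F + 1}"

end

theory Submission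
  imports Defs
begin

text \<open>
  Write \<open>m\<close> for the multiplicity and \<open>F\<close> for the Frobenius number of \<open>S\<close>. Both halves of the first
  condition can be restated as properties of \<open>S\<close> without cardinalities.

  The minimal generators are the atoms of \<open>S\<close>, and distinct atoms are incongruent modulo \<open>m\<close>. Thus
  there are at most \<open>m\<close> of them, and the embedding dimension is maximal iff every residue class
  contains an atom. This amounts to \<open>x + y - m \<in> S\<close> for all nonzero \<open>x, y \<in> S\<close>
  (\<open>MED_semigroup_iff\<close>). On the other side \<open>rPF S \<subseteq> PF S\<close>, because adding a nonzero element
  of \<open>S\<close> to an integer above \<open>F - m\<close> leads beyond \<open>F\<close>. Both sets are finite, so the reduced
  type is maximal iff they are equal (\<open>maximal_reduced_type_iff\<close>).

  Suppose that both properties hold, and let \<open>w \<in> S\<close> be nonzero with \<open>w - m \<notin> S\<close>. By the first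
  property \<open>w - m\<close> is a pseudo-Frobenius number, hence by the second \<open>w - m > F - m\<close>, that is
  \<open>w > F\<close>. Subtracting \<open>m\<close> repeatedly from an element \<open>x \<le> F\<close> of \<open>S\<close> therefore never leaves
  \<open>S\<close> before reaching \<open>0\<close>, so \<open>x\<close> is a multiple of \<open>m\<close> and \<open>S = \<Delta>(F, m)\<close>. Conversely both
  properties can be read off from \<open>\<Delta>(F, m)\<close>.
\<close>

section \<open>Multiplicity and Frobenius number\<close>

lemma ex_least_nonneg_int:
  fixes P :: "int \<Rightarrow> bool"
  assumes "P x" and "\<And>y. P y \<Longrightarrow> 0 \<le> y"
  obtains w where "P w" and "\<And>y. P y \<Longrightarrow> w \<le> y"
proof -
  obtain w where "P w" "\<forall>y. P y \<longrightarrow> nat w \<le> nat y"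
    using ex_has_least_nat[of P x nat] assms(1) by blast
  then show ?thesis
    using that assms(2) by (metis nat_le_eq_zle)
qed

lemma submonoid_natD:
  assumes "submonoid_nat S"
  shows "x \<in> S \<Longrightarrow> 0 \<le> x" and "0 \<in> S" and "x \<in> S \<Longrightarrow> y \<in> S \<Longrightarrow> x + y \<in> S"
  using assms unfolding submonoid_nat_def by auto

lemma submonoid_nat_mult_closed:
  assumes "submonoid_nat S" "a \<in> S" "0 \<le> k"
  shows "k * a \<in> S"
  using assms(3)
proof (induction k rule: int_ge_induct)
  case base
  then show ?case using submonoid_natD(2)[OF assms(1)] by simp
next
  case (step i)
  then show ?case using submonoid_natD(3)[OF assms(1) step.IH assms(2)]
    by (simp add: algebra_simps)
qed

lemma frobenius_greatest_gap:
  assumes "numerical_semigroup S"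
  shows "frobenius S \<notin> S" and "frobenius S < x \<Longrightarrow> x \<in> S"
proof -
  \<comment> \<open>All gaps from \<open>-1\<close> upwards; starting at \<open>-1\<close> keeps the set nonempty even if \<open>S\<close> is all
    of the naturals.\<close>
  let ?G = "insert (-1) ({0..} - S)"
  have fin: "finite ?G" using assms unfolding numerical_semigroup_def by blast
  have "-1 \<notin> S"
    using assms unfolding numerical_semigroup_def submonoid_nat_def by force
  then have gap: "Max ?G \<notin> S" using Max_in[OF fin] by auto
  have above: "y \<le> Max ?G" if "y \<notin> S" for y
  proof (cases "0 \<le> y")
    case True
    then show ?thesis using that fin by (intro Max_ge) auto
  next
    case False
    then show ?thesis using Max_ge[OF fin, of "-1"] by simp
  qed
  have "frobenius S = Max ?G"
    unfolding frobenius_def using gap above by (intro Greatest_equality) auto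
  then show "frobenius S \<notin> S" and "frobenius S < x \<Longrightarrow> x \<in> S"
    using gap above by (auto simp: not_less[symmetric])
qed

lemma mult_of_least:
  assumes "numerical_semigroup S"
  shows "mult_of S \<in> S" and "0 < mult_of S" and "x \<in> S \<Longrightarrow> x \<noteq> 0 \<Longrightarrow> mult_of S \<le> x"
proof -
  have sub: "submonoid_nat S" using assms unfolding numerical_semigroup_def by blast
  have "max 1 (frobenius S + 1) \<in> S"
    using frobenius_greatest_gap(2)[OF assms] by simp
  then have "max 1 (frobenius S + 1) \<in> S - {0}" by auto
  then obtain w where w: "w \<in> S - {0}" "\<And>y. y \<in> S - {0} \<Longrightarrow> w \<le> y"
    using ex_least_nonneg_int[of "\<lambda>x. x \<in> S - {0}"] submonoid_natD(1)[OF sub]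
    by (metis DiffD1)
  then have "mult_of S = w"
    unfolding mult_of_def by (intro Least_equality) auto
  then show "mult_of S \<in> S" and "0 < mult_of S" and "x \<in> S \<Longrightarrow> x \<noteq> 0 \<Longrightarrow> mult_of S \<le> x"
    using w submonoid_natD(1)[OF sub, of w] by auto
qed

section \<open>Atoms and the embedding dimension\<close>

definition atoms :: "int set \<Rightarrow> int set" where
  "atoms S = {x \<in> S - {0}. \<forall>y\<in>S - {0}. \<forall>z\<in>S - {0}. x \<noteq> y + z}"

text \<open>
  Removing an atom from \<open>S\<close> leaves a submonoid, so a generating set cannot omit it.
\<close>

lemma atoms_subset_generators:
  assumes "submonoid_nat S" and "submonoid_nat hull A = S"
  shows "atoms S \<subseteq> A"
proof
  fix a assume a: "a \<in> atoms S"
  show "a \<in> A"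
  proof (rule ccontr)
    assume "a \<notin> A"
    have "x + y \<noteq> a" if "x \<in> S - {a}" "y \<in> S - {a}" for x y
      using a that unfolding atoms_def by (cases "x = 0 \<or> y = 0") auto
    then have "submonoid_nat (S - {a})"
      using a assms(1) unfolding submonoid_nat_def by (auto simp: atoms_def)
    moreover have "A \<subseteq> S - {a}"
      using hull_subset[of A submonoid_nat] assms(2) \<open>a \<notin> A\<close> by auto
    ultimately have "S \<subseteq> S - {a}"
      using hull_minimal[of A "S - {a}" submonoid_nat] assms(2) by simp
    then show False using a unfolding atoms_def by blast
  qed
qed

text \<open>
  An element that is not an atom is a sum of two strictly smaller ones, so splitting terminates.
\<close>

lemma atoms_generate:
  assumes "submonoid_nat S"
  shows "submonoid_nat hull atoms S = S"
proof
  show "submonoid_nat hull atoms S \<subseteq> S"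
    using assms by (intro hull_minimal) (auto simp: atoms_def)
  have "x \<in> T" if "x \<in> S" "submonoid_nat T" "atoms S \<subseteq> T" for x T
    using that(1)
  proof (induction "nat x" arbitrary: x rule: less_induct)
    case less
    consider "x = 0" | "x \<in> atoms S"
      | y z where "y \<in> S - {0}" "z \<in> S - {0}" "x = y + z"
      using less.prems unfolding atoms_def by blast
    then show ?case
    proof cases
      case 1
      then show ?thesis using submonoid_natD(2)[OF that(2)] by simp
    next
      case 2
      then show ?thesis using that(3) by blast
    next
      case 3
      then have "0 < y" "0 < z"
        using submonoid_natD(1)[OF assms, of y] submonoid_natD(1)[OF assms, of z] by auto
      then have "y \<in> T" "z \<in> T"
        using less.hyps[of y] less.hyps[of z] 3 by auto
      then show ?thesis using 3 submonoid_natD(3)[OF that(2)] by simp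
    qed
  qed
  then show "S \<subseteq> submonoid_nat hull atoms S"
    unfolding hull_def by blast
qed

lemma msg_eq_atoms:
  assumes "submonoid_nat S"
  shows "msg S = atoms S"
  unfolding msg_def
proof (rule the_equality)
  show "minimal_generating_system S (atoms S)"
    unfolding minimal_generating_system_def
    using atoms_generate[OF assms] atoms_subset_generators[OF assms] by blast
next
  fix A assume "minimal_generating_system S A"
  then show "A = atoms S"
    unfolding minimal_generating_system_def
    using atoms_generate[OF assms] atoms_subset_generators[OF assms] by blast
qed

text \<open>
  If two atoms were congruent, the larger would be the smaller plus a positive multiple of the
  multiplicity, hence decomposable.
\<close>

lemma inj_on_atoms_mod_mult:
  assumes "numerical_semigroup S"
  shows "inj_on (\<lambda>a. a mod mult_of S) (atoms S)"
proof -
  let ?m = "mult_of S"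
  have sub: "submonoid_nat S" using assms unfolding numerical_semigroup_def by blast
  have no: "\<not> a < b" if ab: "a \<in> atoms S" "b \<in> atoms S" "a mod ?m = b mod ?m" for a b
  proof
    assume "a < b"
    obtain k where k: "b - a = ?m * k"
      using ab(3) mod_eq_dvd_iff[of b ?m a] by (metis dvdE)
    have "0 \<le> k"
      using k \<open>a < b\<close> mult_of_least(2)[OF assms]
      by (metis diff_gt_0_iff_gt less_imp_le zero_less_mult_pos)
    then have "b - a \<in> S"
      using submonoid_nat_mult_closed[OF sub mult_of_least(1)[OF assms]] k
      by (simp add: mult.commute)
    moreover have "b = a + (b - a)" by simp
    ultimately show False
      using ab(1,2) \<open>a < b\<close> unfolding atoms_def by fastforce
  qed
  show ?thesis
    by (rule inj_onI) (metis no linorder_less_linear)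
qed

lemma atoms_mod_mult_subset:
  assumes "numerical_semigroup S"
  shows "(\<lambda>a. a mod mult_of S) ` atoms S \<subseteq> {0..<mult_of S}"
  using mult_of_least(2)[OF assms] by auto

text \<open>
  Since atoms are determined by their residues, counting \<open>m\<close> atoms means finding one in each
  residue class.
\<close>

lemma MED_semigroup_iff_residues:
  assumes "numerical_semigroup S"
  shows "MED_semigroup S \<longleftrightarrow> (\<lambda>a. a mod mult_of S) ` atoms S = {0..<mult_of S}"
    (is "_ \<longleftrightarrow> ?f ` _ = ?R")
proof -
  have "submonoid_nat S" using assms unfolding numerical_semigroup_def by blast
  then have "embdim S = card (?f ` atoms S)"
    unfolding embdim_def
    using card_image[OF inj_on_atoms_mod_mult[OF assms]] by (simp add: msg_eq_atoms)
  moreover have "card (?f ` atoms S) = card ?R \<longleftrightarrow> ?f ` atoms S = ?R"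
    using card_subset_eq[OF _ atoms_mod_mult_subset[OF assms]] by auto
  ultimately show ?thesis
    using assms mult_of_least(2)[OF assms] unfolding MED_semigroup_def by auto
qed

text \<open>
  An atom congruent to \<open>x + y\<close> cannot be \<open>x + y\<close> plus a nonnegative multiple of \<open>m\<close>, since the
  multiple could be absorbed into \<open>y\<close> to give a decomposition. Hence it is at most \<open>x + y - m\<close>, and
  adding multiples of \<open>m\<close> to it reaches \<open>x + y - m\<close> within \<open>S\<close>. Conversely, \<open>m\<close> is an atom in
  the class of \<open>0\<close>. Under the closure property the least element \<open>w\<close> of any other class has no
  decomposition, since \<open>w = x + y\<close> would put the smaller \<open>w - m\<close> into \<open>S\<close>, within the same class.
\<close>

lemma MED_semigroup_iff:
  assumes "numerical_semigroup S"
  shows "MED_semigroup S \<longleftrightarrow> (\<forall>x\<in>S - {0}. \<forall>y\<in>S - {0}. x + y - mult_of S \<in> S)"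
proof -
  define m where "m = mult_of S"
  have sub: "submonoid_nat S" using assms unfolding numerical_semigroup_def by blast
  have m: "m \<in> S" "0 < m" and least: "\<And>x. x \<in> S \<Longrightarrow> x \<noteq> 0 \<Longrightarrow> m \<le> x"
    using mult_of_least[OF assms] unfolding m_def by auto
  have km: "x + k * m \<in> S" if "x \<in> S" "0 \<le> k" for x k
    using submonoid_natD(3)[OF sub that(1)] submonoid_nat_mult_closed[OF sub m(1) that(2)] by blast
  have "(\<lambda>a. a mod m) ` atoms S = {0..<m} \<longleftrightarrow> (\<forall>x\<in>S - {0}. \<forall>y\<in>S - {0}. x + y - m \<in> S)"
  proof (intro iffI ballI)
    fix x y assume res: "(\<lambda>a. a mod m) ` atoms S = {0..<m}" and x: "x \<in> S - {0}" and y: "y \<in> S - {0}"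
    have "(x + y) mod m \<in> (\<lambda>a. a mod m) ` atoms S" using res m(2) by simp
    then obtain a where a: "a \<in> atoms S" "(x + y) mod m = a mod m" by blast
    obtain k where k: "x + y - a = k * m"
      using a(2) mod_eq_dvd_iff[of "x + y" m a] by (metis dvdE mult.commute)
    have "1 \<le> k"
    proof (rule ccontr)
      assume "\<not> 1 \<le> k"
      then have "0 \<le> - k * m" using m(2) by (simp add: mult_nonpos_nonneg)
      define z where "z = y + (- k) * m"
      have "z \<in> S" using km[of y "- k"] y \<open>\<not> 1 \<le> k\<close> unfolding z_def by simp
      moreover have "0 < z"
        using y submonoid_natD(1)[OF sub, of y] \<open>0 \<le> - k * m\<close> unfolding z_def by auto
      moreover have "a = x + z" using k unfolding z_def by simp
      ultimately show False using a(1) x unfolding atoms_def by auto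
    qed
    moreover have "x + y - m = a + (k - 1) * m" using k by (simp add: algebra_simps)
    moreover have "a \<in> S" using a(1) unfolding atoms_def by blast
    ultimately show "x + y - m \<in> S" using km[of a "k - 1"] by simp
  next
    assume closed: "\<forall>x\<in>S - {0}. \<forall>y\<in>S - {0}. x + y - m \<in> S"
    have "r \<in> (\<lambda>a. a mod m) ` atoms S" if r: "r \<in> {0..<m}" for r
    proof (cases "r = 0")
      case True
      have "m \<in> atoms S"
        unfolding atoms_def using m least by (auto; smt (verit))
      then show ?thesis using True by (auto intro: image_eqI[of _ _ m])
    next
      case False
      \<comment> \<open>A representative of the class lying beyond the Frobenius number.\<close>
      define b where "b = r + (\<bar>frobenius S\<bar> + 1) * m"
      have "\<bar>frobenius S\<bar> + 1 \<le> (\<bar>frobenius S\<bar> + 1) * m"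
        using m(2) mult_left_mono[of 1 m "\<bar>frobenius S\<bar> + 1"] by simp
      moreover have "0 \<le> r" using r by simp
      ultimately have "frobenius S < b" unfolding b_def by linarith
      then have "b \<in> S \<and> b mod m = r"
        using frobenius_greatest_gap(2)[OF assms] r unfolding b_def by simp
      then obtain w where w: "w \<in> S" "w mod m = r"
        and wmin: "\<And>v. v \<in> S \<Longrightarrow> v mod m = r \<Longrightarrow> w \<le> v"
        using ex_least_nonneg_int[of "\<lambda>v. v \<in> S \<and> v mod m = r"] submonoid_natD(1)[OF sub]
        by metis
      have "w - m \<notin> S" using wmin[of "w - m"] w(2) m(2) by auto
      moreover have "w \<noteq> 0" using w(2) False by auto
      ultimately have "w \<in> atoms S" using w(1) closed unfolding atoms_def by blast
      then show ?thesis using w(2) by blast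
    qed
    then show "(\<lambda>a. a mod m) ` atoms S = {0..<m}"
      using atoms_mod_mult_subset[OF assms] unfolding m_def by blast
  qed
  then show ?thesis using MED_semigroup_iff_residues[OF assms] unfolding m_def by simp
qed

section \<open>Pseudo-Frobenius numbers and the reduced type\<close>

lemma rPF_subset_PF:
  assumes "numerical_semigroup S"
  shows "rPF S \<subseteq> PF S"
  using mult_of_least(3)[OF assms] frobenius_greatest_gap(2)[OF assms]
  unfolding rPF_def PF_def by fastforce

lemma finite_PF:
  assumes "numerical_semigroup S"
  shows "finite (PF S)"
proof (rule finite_subset)
  have sub: "submonoid_nat S" using assms unfolding numerical_semigroup_def by blast
  show "PF S \<subseteq> {- mult_of S..frobenius S}"
  proof
    fix x assume x: "x \<in> PF S"
    then have "x + mult_of S \<in> S"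
      using mult_of_least(1,2)[OF assms] unfolding PF_def by auto
    then have "0 \<le> x + mult_of S" by (rule submonoid_natD(1)[OF sub])
    moreover have "x \<le> frobenius S"
      using x frobenius_greatest_gap(2)[OF assms, of x] unfolding PF_def by force
    ultimately show "x \<in> {- mult_of S..frobenius S}" by simp
  qed
qed simp

lemma maximal_reduced_type_iff:
  assumes "numerical_semigroup S"
  shows "maximal_reduced_type S \<longleftrightarrow> PF S = rPF S"
  unfolding maximal_reduced_type_def reduced_type_def type_of_def
  using card_subset_eq[OF finite_PF[OF assms] rPF_subset_PF[OF assms]] by auto

section \<open>The semigroups \<open>\<Delta>(F, m)\<close>\<close>

lemma mem_Delta_iff:
  assumes "0 < m" "0 \<le> F"
  shows "x \<in> Delta F m \<longleftrightarrow> (m dvd x \<and> 0 \<le> x) \<or> F < x"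
proof -
  have "(\<exists>l\<ge>0. x = l * m) \<longleftrightarrow> m dvd x \<and> 0 \<le> x"
    using assms(1) by (auto simp: dvd_def mult.commute zero_le_mult_iff)
  then show ?thesis using assms(2) unfolding Delta_def by auto
qed

lemma frobenius_Delta:
  assumes "0 < m" "0 \<le> F" "\<not> m dvd F"
  shows "frobenius (Delta F m) = F"
  unfolding frobenius_def
  using assms by (intro Greatest_equality) (auto simp: mem_Delta_iff)

lemma mult_of_Delta:
  assumes "0 < m" "m < F"
  shows "mult_of (Delta F m) = m"
  unfolding mult_of_def
  using assms by (intro Least_equality) (auto simp: mem_Delta_iff dest: zdvd_imp_le)

lemma MED_semigroup_Delta:
  assumes "numerical_semigroup (Delta F m)" "0 < m" "m < F"
  shows "MED_semigroup (Delta F m)"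
proof -
  have "x + y - m \<in> Delta F m" if xy: "x \<in> Delta F m - {0}" "y \<in> Delta F m - {0}" for x y
  proof -
    have ge: "m \<le> x" "m \<le> y"
      using mult_of_least(3)[OF assms(1)] mult_of_Delta[OF assms(2,3)] xy by auto
    have "m dvd x \<and> m dvd y \<or> F < x \<or> F < y"
      using xy assms(2,3) by (auto simp: mem_Delta_iff)
    then show ?thesis using ge assms(2,3) by (auto simp: mem_Delta_iff)
  qed
  then show ?thesis
    using MED_semigroup_iff[OF assms(1)] mult_of_Delta[OF assms(2,3)] by simp
qed

text \<open>
  A pseudo-Frobenius number \<open>x\<close> satisfies \<open>x + m \<in> \<Delta>(F, m)\<close>. If \<open>x + m \<le> F\<close>, then \<open>x\<close> is a
  multiple of \<open>m\<close> outside the semigroup, which leaves only \<open>-m\<close>; but \<open>-m + (F + m) = F\<close> is a gap.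
\<close>

lemma maximal_reduced_type_Delta:
  assumes "numerical_semigroup (Delta F m)" "0 < m" "m < F" "\<not> m dvd F"
  shows "maximal_reduced_type (Delta F m)"
proof -
  have mF: "mult_of (Delta F m) = m" "frobenius (Delta F m) = F"
    using mult_of_Delta frobenius_Delta assms by auto
  have "x \<in> rPF (Delta F m)" if x: "x \<in> PF (Delta F m)" for x
  proof -
    have gap: "x \<notin> Delta F m"
      and add: "\<And>s. s \<in> Delta F m \<Longrightarrow> s \<noteq> 0 \<Longrightarrow> x + s \<in> Delta F m"
      using x unfolding PF_def by auto
    have "x + m \<in> Delta F m" using add[of m] assms(2,3) by (simp add: mem_Delta_iff)
    moreover have "F < x + m" if dvd: "m dvd x" and nonneg: "0 \<le> x + m"
    proof -
      have "x < 0" using gap dvd assms(2,3) by (auto simp: mem_Delta_iff)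
      then have "x + m = 0"
        using zdvd_imp_le[of m "x + m"] dvd nonneg by force
      moreover have "x + (F + m) \<in> Delta F m"
        using add[of "F + m"] assms(2,3) by (simp add: mem_Delta_iff)
      ultimately have "F \<in> Delta F m" by (simp add: algebra_simps)
      then show ?thesis using assms(2-4) by (auto simp: mem_Delta_iff)
    qed
    ultimately have "F < x + m" using assms(2,3) by (auto simp: mem_Delta_iff)
    then show ?thesis
      using gap assms(2,3) unfolding rPF_def mF by (auto simp: mem_Delta_iff)
  qed
  then show ?thesis
    using maximal_reduced_type_iff[OF assms(1)] rPF_subset_PF[OF assms(1)] by blast
qed

section \<open>The characterisation\<close>

lemma MED_maximal_reduced_type_imp_Delta:
  assumes S: "numerical_semigroup S" and "0 \<le> frobenius S"
    and "MED_semigroup S" and "maximal_reduced_type S"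
  shows "S = Delta (frobenius S) (mult_of S)"
proof -
  define m F where "m = mult_of S" and "F = frobenius S"
  have sub: "submonoid_nat S" using S unfolding numerical_semigroup_def by blast
  have m: "m \<in> S" "0 < m" using mult_of_least[OF S] unfolding m_def by auto
  have closed: "x + y - m \<in> S" if "x \<in> S - {0}" "y \<in> S - {0}" for x y
    using assms(3) that MED_semigroup_iff[OF S] unfolding m_def by blast
  have large: "F < w" if w: "w \<in> S" "w \<noteq> 0" "w - m \<notin> S" for w
  proof -
    have "w - m \<in> PF S"
      using w closed[of w] unfolding PF_def by (auto simp: algebra_simps)
    then have "w - m \<in> rPF S" using assms(4) maximal_reduced_type_iff[OF S] by simp
    then show ?thesis unfolding rPF_def m_def F_def by auto
  qed
  have "m dvd x" if "x \<in> S" "x \<le> F" for x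
    using that
  proof (induction "nat x" arbitrary: x rule: less_induct)
    case less
    show ?case
    proof (cases "x = 0")
      case False
      then have "x - m \<in> S" using large[of x] less.prems by force
      moreover have "0 < x" using False submonoid_natD(1)[OF sub less.prems(1)] by simp
      ultimately have "m dvd x - m" using less.hyps[of "x - m"] less.prems m(2) by simp
      then show ?thesis by (metis dvd_add_triv_right_iff diff_add_cancel)
    qed simp
  qed
  moreover have "x \<in> S" if "m dvd x" "0 \<le> x" for x
  proof -
    obtain k where "x = k * m" using \<open>m dvd x\<close> by (metis dvdE mult.commute)
    then show ?thesis
      using submonoid_nat_mult_closed[OF sub m(1), of k] \<open>0 \<le> x\<close> m(2)
      by (simp add: zero_le_mult_iff)
  qed
  ultimately have "S = Delta F m"
    using frobenius_greatest_gap(2)[OF S] submonoid_natD(1)[OF sub] mem_Delta_iff[OF m(2), of F]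
      assms(2) unfolding F_def by (metis subsetI subset_antisym not_less)
  then show ?thesis unfolding F_def m_def .
qed

theorem theorem2:
  fixes S :: "int set"
  assumes "numerical_semigroup S"
    and "mult_of S < frobenius S"
  shows "(MED_semigroup S \<and> maximal_reduced_type S) \<longleftrightarrow>
         (\<exists>F m :: int. 2 \<le> m \<and> m < F \<and> \<not> m dvd F \<and> S = Delta F m)"
proof
  let ?m = "mult_of S" and ?F = "frobenius S"
  assume "MED_semigroup S \<and> maximal_reduced_type S"
  moreover have pos: "0 < ?m" using mult_of_least(2)[OF assms(1)] .
  ultimately have "S = Delta ?F ?m"
    using MED_maximal_reduced_type_imp_Delta[OF assms(1)] assms(2) by simp
  moreover from this have ndvd: "\<not> ?m dvd ?F"
    using frobenius_greatest_gap(1)[OF assms(1)] mem_Delta_iff[of ?m ?F ?F] pos assms(2) by simp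
  moreover have "2 \<le> ?m"
  proof -
    have "?m \<noteq> 1" using ndvd by auto
    then show ?thesis using pos by simp
  qed
  ultimately show "\<exists>F m :: int. 2 \<le> m \<and> m < F \<and> \<not> m dvd F \<and> S = Delta F m"
    using assms(2) by blast
next
  assume "\<exists>F m :: int. 2 \<le> m \<and> m < F \<and> \<not> m dvd F \<and> S = Delta F m"
  then obtain F m :: int where "2 \<le> m" "m < F" "\<not> m dvd F" "S = Delta F m" by blast
  then show "MED_semigroup S \<and> maximal_reduced_type S"
    using MED_semigroup_Delta maximal_reduced_type_Delta assms(1) by simp
qed

end
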